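(* Suppose that $A$ and $B$ are paramonotone, $\sigma\tau LL^*=\operatorname{Id}_Y$, and $K\cap\ker L^*\neq\varnothing$. Let $(x_0,y_0)\in X\times Y$. Set $w_0:=\tfrac{1}{\sqrt{\sigma}}(x_0-\sigma L^*y_0)$. Then $$P_{\operatorname{Fix}\widetilde{T}}\,w_0=\tfrac{1}{\sqrt{\sigma}}P_{Z-\sigma L^*K}(\sqrt{\sigma}\,w_0),$$ while the $\mathbf{M}$-projection of $(x_0,y_0)$ onto $\operatorname{Fix}\mathbf{T}$ is given by $$\Big(P_Z(x_0-\sigma L^*y_0),\ J_{\tau B^{-1}}\big(2\tau LP_Z(x_0-\sigma L^*y_0)-\tau LP_{Z-\sigma L^*K}(\sqrt{\sigma}\,w_0)\big)\Big).$$
   Context: $X$ and $Y$ are real Hilbert spaces, $L\colon X\to Y$ is continuous and linear with adjoint $L^*$, $A\colon X\rightrightarrows X$ and $B\colon Y\rightrightarrows Y$ are maximally monotone set-valued operators, and $\sigma>0$, $\tau>0$ satisfy $\sigma\tau\|L\|^2\leq1$. Inverses are in the sense of set-valued operators; $J_{N}:=(\operatorname{Id}+N)^{-1}$ is the resolvent of $N$; $\operatorname{Fix}$ denotes the fixed point set; $P_C$ is the projection onto a nonempty closed convex set $C$. Set $$Z:=\{x\in X: 0\in Ax+L^*BLx\},\qquad K:=\{y\in Y: 0\in B^{-1}y-LA^{-1}(-L^*y)\}.$$ A monotone operator $A$ is paramonotone if $(x_0,u_0),(x_1,u_1)\in\operatorname{gra}A$ and $\langle x_0-x_1,u_0-u_1\rangle=0$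 imply $(x_0,u_1)\in\operatorname{gra}A$ and $(x_1,u_0)\in\operatorname{gra}A$. The Chambolle-Pock operator $\mathbf{T}\colon X\times Y\to X\times Y$ is $\mathbf{T}(x,y)=(x^+,y^+)$ with $x^+=J_{\sigma A}(x-\sigma L^*y)$ and $y^+=J_{\tau B^{-1}}(y+\tau L(2x^+-x))$. On $X\times Y$ define the block operators $$\mathbf{M}=\begin{bmatrix}\tfrac1\sigma\operatorname{Id}_X&-L^*\\-L&\tfrac1\tau\operatorname{Id}_Y\end{bmatrix},\qquad \mathbf{A}=\begin{bmatrix}A&L^*\\-L&B^{-1}\end{bmatrix},$$ i.e. $\mathbf{A}(x,y)=(Ax+L^*y)\times(-Lx+B^{-1}y)$. In the case $\sigma\tau LL^*=\operatorname{Id}_Y$, let $C\colon X\to X\times Y$, $Cx=(\tfrac{1}{\sqrt\sigma}x,-\sqrt{\sigma}Lx)$, so that $CC^*=\mathbf{M}$, and let $\widetilde{T}:=C^*(\mathbf{A}+\mathbf{M})^{-1}C\colon X\to X$ be the reduced operator (where $(\mathbf{A}+\mathbf{M})^{-1}$ is single-valued with full domain). The preconditioner $\mathbf{M}$ is positive semidefinite and induces the seminorm $\|u\|_{\mathbf{M}}:=\sqrt{\langle u,\mathbf{M}u\rangle}$ on $X\times Y$; the $\mathbf{M}$-projection of $u_0$ onto $\operatorname{Fix}\mathbf{T}$ is the (well-defined, unique) minimizer of $u\mapsto\|u-u_0\|_{\mathbf{M}}$ over $u\in\operatorname{Fix}\mathbf{T}$. *)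

theory Defs
  imports "HOL-Analysis.Analysis"
begin

text \<open>
  Set-valued operators on a space are functions \<open>'a \<Rightarrow> 'a set\<close>; the pair \<open>(x, u)\<close>
  lies in the graph of \<open>A\<close> iff \<open>u \<in> A x\<close>. Real Hilbert spaces are types of sort
  \<open>{real_inner, complete_space}\<close>. On sets, \<open>+\<close> is the Minkowski sum of
  \<open>HOL-Library.Set_Algebras\<close>, whereas \<open>-\<close> is set difference, so Minkowski
  differences are written as comprehensions.
\<close>

definition op_inverse :: "('a \<Rightarrow> 'b set) \<Rightarrow> 'b \<Rightarrow> 'a set" where
  "op_inverse N u = {x. u \<in> N x}"

definition monotone_op :: "('a::real_inner \<Rightarrow> 'a set) \<Rightarrow> bool" where
  "monotone_op A \<longleftrightarrow> (\<forall>x y. \<forall>u\<in>A x. \<forall>v\<in>A y. 0 \<le> (x - y) \<bullet> (u - v))"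

definition maximally_monotone :: "('a::real_inner \<Rightarrow> 'a set) \<Rightarrow> bool" where
  "maximally_monotone A \<longleftrightarrow>
     monotone_op A \<and> (\<forall>A'. monotone_op A' \<and> (\<forall>x. A x \<subseteq> A' x) \<longrightarrow> A' = A)"

definition paramonotone :: "('a::real_inner \<Rightarrow> 'a set) \<Rightarrow> bool" where
  "paramonotone A \<longleftrightarrow> monotone_op A \<and>
     (\<forall>x0 x1. \<forall>u0\<in>A x0. \<forall>u1\<in>A x1. (x0 - x1) \<bullet> (u0 - u1) = 0 \<longrightarrow> u1 \<in> A x0 \<and> u0 \<in> A x1)"

definition scale_op :: "real \<Rightarrow> ('a::real_vector \<Rightarrow> 'a set) \<Rightarrow> 'a \<Rightarrow> 'a set" where
  "scale_op r N x = (\<lambda>u. r *\<^sub>R u) ` N x"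

text \<open>
  For maximally monotone \<open>N\<close> the set \<open>(Id + N)\<^sup>-\<^sup>1 x\<close> is a singleton (Minty), and
  \<open>resolvent N x\<close> is its element; \<open>the_elem\<close> is unspecified on other sets.
\<close>
definition resolvent :: "('a::real_vector \<Rightarrow> 'a set) \<Rightarrow> 'a \<Rightarrow> 'a" where
  "resolvent N x = the_elem (op_inverse (\<lambda>p. {p} + N p) x)"

definition Fix :: "('a \<Rightarrow> 'a) \<Rightarrow> 'a set" where
  "Fix T = {x. T x = x}"

text \<open>
  The metric projection; well defined on nonempty closed convex subsets of a Hilbert
  space. The library's \<open>closest_point\<close> is restricted to Heine-Borel spaces.
\<close>
definition proj :: "'a::real_inner set \<Rightarrow> 'a \<Rightarrow> 'a" where
  "proj C x = (THE p. is_arg_min (\<lambda>q. norm (q - x)) (\<lambda>q. q \<in> C) p)"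

definition op_seminorm :: "('a::real_inner \<Rightarrow> 'a) \<Rightarrow> 'a \<Rightarrow> real" where
  "op_seminorm M u = sqrt (u \<bullet> M u)"

definition is_seminorm_proj :: "('a::real_inner \<Rightarrow> 'a) \<Rightarrow> 'a set \<Rightarrow> 'a \<Rightarrow> 'a \<Rightarrow> bool" where
  "is_seminorm_proj M S u0 p \<longleftrightarrow> is_arg_min (\<lambda>u. op_seminorm M (u - u0)) (\<lambda>u. u \<in> S) p"

definition seminorm_proj :: "('a::real_inner \<Rightarrow> 'a) \<Rightarrow> 'a set \<Rightarrow> 'a \<Rightarrow> 'a" where
  "seminorm_proj M S u0 = (THE p. is_seminorm_proj M S u0 p)"

definition primal_solutions ::
  "('x::real_inner \<Rightarrow> 'x set) \<Rightarrow> ('y::real_inner \<Rightarrow> 'y set) \<Rightarrow> ('x \<Rightarrow> 'y) \<Rightarrow> 'x set" where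
  "primal_solutions A B L = {x. 0 \<in> A x + adjoint L ` B (L x)}"

definition dual_solutions ::
  "('x::real_inner \<Rightarrow> 'x set) \<Rightarrow> ('y::real_inner \<Rightarrow> 'y set) \<Rightarrow> ('x \<Rightarrow> 'y) \<Rightarrow> 'y set" where
  "dual_solutions A B L =
     {y. 0 \<in> {v - L x | v x. v \<in> op_inverse B y \<and> x \<in> op_inverse A (- adjoint L y)}}"

definition CP_op ::
  "('x::real_inner \<Rightarrow> 'x set) \<Rightarrow> ('y::real_inner \<Rightarrow> 'y set) \<Rightarrow> ('x \<Rightarrow> 'y) \<Rightarrow> real \<Rightarrow> real
     \<Rightarrow> 'x \<times> 'y \<Rightarrow> 'x \<times> 'y" where
  "CP_op A B L \<sigma> \<tau> = (\<lambda>(x, y).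
     let x' = resolvent (scale_op \<sigma> A) (x - \<sigma> *\<^sub>R adjoint L y);
         y' = resolvent (scale_op \<tau> (op_inverse B)) (y + \<tau> *\<^sub>R L (2 *\<^sub>R x' - x))
     in (x', y'))"

definition CP_precond ::
  "('x::real_inner \<Rightarrow> 'y::real_inner) \<Rightarrow> real \<Rightarrow> real \<Rightarrow> 'x \<times> 'y \<Rightarrow> 'x \<times> 'y" where
  "CP_precond L \<sigma> \<tau> = (\<lambda>(x, y).
     ((1 / \<sigma>) *\<^sub>R x - adjoint L y, - L x + (1 / \<tau>) *\<^sub>R y))"

definition block_op ::
  "('x::real_inner \<Rightarrow> 'x set) \<Rightarrow> ('y::real_inner \<Rightarrow> 'y set) \<Rightarrow> ('x \<Rightarrow> 'y)
     \<Rightarrow> 'x \<times> 'y \<Rightarrow> ('x \<times> 'y) set" where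
  "block_op A B L = (\<lambda>(x, y).
     (A x + {adjoint L y}) \<times> ({- L x} + op_inverse B y))"

definition CP_factor :: "('x::real_vector \<Rightarrow> 'y::real_vector) \<Rightarrow> real \<Rightarrow> 'x \<Rightarrow> 'x \<times> 'y" where
  "CP_factor L \<sigma> x = ((1 / sqrt \<sigma>) *\<^sub>R x, - (sqrt \<sigma> *\<^sub>R L x))"

definition reduced_op ::
  "('x::real_inner \<Rightarrow> 'x set) \<Rightarrow> ('y::real_inner \<Rightarrow> 'y set) \<Rightarrow> ('x \<Rightarrow> 'y) \<Rightarrow> real \<Rightarrow> real
     \<Rightarrow> 'x \<Rightarrow> 'x" where
  "reduced_op A B L \<sigma> \<tau> w =
     adjoint (CP_factor L \<sigma>)
       (the_elem (op_inverse (\<lambda>u. block_op A B L u + {CP_precond L \<sigma> \<tau> u}) (CP_factor L \<sigma> w)))"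

end

theory Submission
  imports Defs
begin

text \<open>
  Everything takes place in the set \<open>kkt\<close> of pairs \<open>(x, y)\<close> with \<open>- L\<^sup>* y \<in> A x\<close> and
  \<open>y \<in> B (L x)\<close>. Its coordinate projections are the primal solutions \<open>Z\<close> and the dual solutions
  \<open>K\<close>, and paramonotonicity allows the partners of two such pairs to be exchanged, so that it is
  the full product \<open>Z \<times> K\<close> (\<open>kkt_eq_Times\<close>). The computation behind the exchange also shows that
  differences of points of \<open>Z\<close> are orthogonal to differences of points of \<open>L\<^sup>* K\<close>
  (\<open>solutions_orthogonal\<close>).

  The fixed points of the Chambolle-Pock operator are exactly these pairs. When
  \<open>\<sigma> \<tau> L L\<^sup>*\<close> is the identity, the preconditioner satisfies
  \<open>\<parallel>(x, y)\<parallel>\<^sub>M = \<parallel>x - \<sigma> L\<^sup>* y\<parallel> / sqrt \<sigma>\<close>, so it sees a pair only through its shadow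
  \<open>x - \<sigma> L\<^sup>* y\<close>. The reduced operator is the Chambolle-Pock operator in the coordinate
  \<open>(x - \<sigma> L\<^sup>* y) / sqrt \<sigma>\<close>, and its fixed points are the shadows of the pairs in \<open>Z \<times> K\<close>, divided by
  \<open>sqrt \<sigma>\<close> (\<open>Fix_reduced_op\<close>). This gives the first formula by scaling, and turns the
  \<open>M\<close>-projection onto \<open>Z \<times> K\<close> into the metric projection onto the set \<open>Z - \<sigma> L\<^sup>* K\<close> of shadows.

  By orthogonality a shadow in this set determines its pair \<open>(z, k)\<close>, with a bound that makes
  the set closed. If some point of \<open>K\<close> lies in the kernel of \<open>L\<^sup>*\<close>, then the differences of
  points of \<open>Z\<close> are orthogonal to \<open>L\<^sup>* K\<close> itself; hence the \<open>K\<close>-part of the shadow drops out of the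
  variational inequality, and \<open>z\<close> is the projection onto \<open>Z\<close> (\<open>primal_part_of_proj\<close>). The dual
  part \<open>k\<close> is recovered because a fixed pair reproduces itself in the dual step.

  Three general facts on Hilbert spaces are needed: existence of projections, existence of
  adjoints, and Minty's theorem that resolvents of maximally monotone operators are
  single-valued with full domain. All three come from the variational
  inequality for the infimum of a functional \<open>\<parallel>v\<parallel>\<^sup>2 + d\<close> over a convex set of pairs \<open>(v, d)\<close>
  (\<open>convex_quadratic_infimum\<close>).
\<close>

section \<open>Infima of convex quadratics\<close>

text \<open>
  Strict convexity in \<open>v\<close> makes the first components of a minimising sequence a Cauchy sequence,
  and comparing the sequence with its convex combinations with a fixed \<open>(w, d)\<close> gives the first-order
  condition at the limit \<open>v\<close>. The set need not be closed, so the infimum \<open>s\<close> need not be attained;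
  this is why the first-order condition is phrased with \<open>s\<close>.
\<close>
lemma convex_quadratic_infimum:
  fixes S :: "('a::{real_inner, complete_space} \<times> real) set"
  assumes S: "convex S" "S \<noteq> {}"
    and m: "\<And>v d. (v, d) \<in> S \<Longrightarrow> m \<le> (norm v)\<^sup>2 + d"
  obtains s u e v where
    "m \<le> s"
    "\<And>n. (u n, e n) \<in> S" "u \<longlonglongrightarrow> v" "(\<lambda>n. (norm (u n))\<^sup>2 + e n) \<longlonglongrightarrow> s"
    "\<And>w d. (w, d) \<in> S \<Longrightarrow> (norm v)\<^sup>2 + s \<le> 2 * (v \<bullet> w) + d"
proof -
  define h where "h p = (norm (fst p))\<^sup>2 + snd p" for p :: "'a \<times> real"
  define s where "s = Inf (h ` S)"
  have bdd: "bdd_below (h ` S)"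
    using m by (intro bdd_belowI[of _ m]) (auto simp: h_def)
  have s_le: "s \<le> h p" if "p \<in> S" for p
    unfolding s_def using that bdd by (intro cInf_lower) auto
  have "m \<le> s"
    unfolding s_def using S m by (intro cInf_greatest) (auto simp: h_def)
  have "\<exists>p\<in>S. h p < s + 1 / Suc n" for n
  proof -
    have "Inf (h ` S) < s + 1 / Suc n" by (simp add: s_def)
    then show ?thesis using cInf_lessD[of "h ` S"] S by blast
  qed
  then obtain p where p: "\<And>n. p n \<in> S" "\<And>n. h (p n) < s + 1 / Suc n" by metis
  have lim0: "(\<lambda>n. s + 1 / Suc n) \<longlonglongrightarrow> s"
    using tendsto_add[OF tendsto_const LIMSEQ_Suc[OF lim_1_over_n], of s] by simp
  have hlim: "(\<lambda>n. h (p n)) \<longlonglongrightarrow> s"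
    by (rule real_tendsto_sandwich[OF _ _ tendsto_const lim0])
       (use p s_le in \<open>auto intro!: always_eventually less_imp_le\<close>)
  \<comment> \<open>the parallelogram identity, applied at the midpoint of \<open>q\<close> and \<open>r\<close>\<close>
  have mid: "(norm (fst q - fst r))\<^sup>2 \<le> 2 * (h q - s) + 2 * (h r - s)"
    if "q \<in> S" "r \<in> S" for q r
  proof -
    have "(1/2) *\<^sub>R q + (1/2) *\<^sub>R r \<in> S"
      using convexD[OF S(1) that, of "1/2" "1/2"] by simp
    then have "s \<le> h ((1/2) *\<^sub>R q + (1/2) *\<^sub>R r)" by (rule s_le)
    then show ?thesis
      by (simp add: h_def power2_norm_eq_inner inner_simps inner_commute field_simps)
  qed
  have "Cauchy (\<lambda>n. fst (p n))"
  proof (rule metric_CauchyI)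
    fix \<epsilon> :: real assume "\<epsilon> > 0"
    then obtain N where N: "1 / Suc N < \<epsilon>\<^sup>2 / 4"
      using nat_approx_posE[of "\<epsilon>\<^sup>2 / 4"] by auto
    have "dist (fst (p i)) (fst (p j)) < \<epsilon>" if "i \<ge> N" "j \<ge> N" for i j
    proof -
      have "1 / Suc i \<le> 1 / Suc N" "1 / Suc j \<le> 1 / Suc N"
        using that by (auto intro!: divide_left_mono)
      then have "(norm (fst (p i) - fst (p j)))\<^sup>2 < \<epsilon>\<^sup>2"
        using mid[OF p(1) p(1), of i j] p(2)[of i] p(2)[of j] N
        by (simp only: ring_distribs)
      then show ?thesis
        using \<open>\<epsilon> > 0\<close> by (simp add: dist_norm power_less_imp_less_base)
    qed
    then show "\<exists>N. \<forall>i\<ge>N. \<forall>j\<ge>N. dist (fst (p i)) (fst (p j)) < \<epsilon>" by blast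
  qed
  then obtain v where v: "(\<lambda>n. fst (p n)) \<longlonglongrightarrow> v"
    using Cauchy_convergent convergent_def by blast
  have "(norm v)\<^sup>2 + s \<le> 2 * (v \<bullet> w) + d" if q: "(w, d) \<in> S" for w d
  proof -
    define c where "c = 2 * (v \<bullet> w) + d - (norm v)\<^sup>2 - s"
    \<comment> \<open>move a fraction \<open>t\<close> from \<open>p n\<close> towards \<open>(w, d)\<close>, let \<open>n\<close> tend to infinity, and only then
       let \<open>t\<close> tend to 0\<close>
    have small: "0 \<le> c + t * (norm (w - v))\<^sup>2" if t: "0 < t" "t \<le> 1" for t
    proof -
      have "s \<le> h (p n) + t * (2 * (fst (p n) \<bullet> w) + d - (norm (fst (p n)))\<^sup>2 - h (p n))
                + t\<^sup>2 * (norm (w - fst (p n)))\<^sup>2" for n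
      proof -
        have "(1 - t) *\<^sub>R p n + t *\<^sub>R (w, d) \<in> S"
          using convexD[OF S(1) p(1) q, of "1 - t" t] t by simp
        then have "s \<le> h ((1 - t) *\<^sub>R p n + t *\<^sub>R (w, d))" by (rule s_le)
        then show ?thesis
          by (simp add: h_def power2_norm_eq_inner inner_simps inner_commute algebra_simps
              power2_eq_square[of t])
      qed
      moreover have "(\<lambda>n. h (p n) + t * (2 * (fst (p n) \<bullet> w) + d - (norm (fst (p n)))\<^sup>2 - h (p n))
                + t\<^sup>2 * (norm (w - fst (p n)))\<^sup>2)
          \<longlonglongrightarrow> s + t * (2 * (v \<bullet> w) + d - (norm v)\<^sup>2 - s) + t\<^sup>2 * (norm (w - v))\<^sup>2"
        by (intro tendsto_intros hlim v)
      ultimately have "s \<le> s + t * (2 * (v \<bullet> w) + d - (norm v)\<^sup>2 - s) + t\<^sup>2 * (norm (w - v))\<^sup>2"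
        by (intro LIMSEQ_le_const) auto
      then have "0 \<le> t * (c + t * (norm (w - v))\<^sup>2)"
        by (simp add: c_def algebra_simps power2_eq_square)
      then show ?thesis using t by (simp add: zero_le_mult_iff)
    qed
    have "0 \<le> c + (1 / Suc n) * (norm (w - v))\<^sup>2" for n
      using small[of "1 / Suc n"] by simp
    moreover have "(\<lambda>n. c + (1 / Suc n) * (norm (w - v))\<^sup>2) \<longlonglongrightarrow> c + 0 * (norm (w - v))\<^sup>2"
      by (intro tendsto_intros LIMSEQ_Suc[OF lim_1_over_n])
    ultimately have "0 \<le> c + 0 * (norm (w - v))\<^sup>2"
      by (intro LIMSEQ_le_const) auto
    then show ?thesis by (simp add: c_def)
  qed
  then show thesis
    using that[of s "\<lambda>n. fst (p n)" "\<lambda>n. snd (p n)" v] \<open>m \<le> s\<close> p(1) v hlim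
    by (simp add: h_def)
qed

section \<open>Projections and adjoints in Hilbert spaces\<close>

lemma is_arg_min_norm_iff:
  fixes C :: "'a::real_inner set"
  assumes "convex C"
  shows "is_arg_min (\<lambda>q. norm (q - w)) (\<lambda>q. q \<in> C) p \<longleftrightarrow>
     p \<in> C \<and> (\<forall>q\<in>C. (w - p) \<bullet> (q - p) \<le> 0)"
proof safe
  assume min: "is_arg_min (\<lambda>q. norm (q - w)) (\<lambda>q. q \<in> C) p"
  then show p: "p \<in> C" by (simp add: is_arg_min_def)
  fix q assume q: "q \<in> C"
  have small: "2 * ((w - p) \<bullet> (q - p)) \<le> t * (norm (q - p))\<^sup>2" if t: "0 < t" "t \<le> 1" for t
  proof -
    have "(1 - t) *\<^sub>R p + t *\<^sub>R q \<in> C"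
      using convexD[OF assms p q, of "1 - t" t] t by simp
    then have "norm (p - w) \<le> norm ((1 - t) *\<^sub>R p + t *\<^sub>R q - w)"
      using min by (auto simp: is_arg_min_linorder)
    then have "(norm (p - w))\<^sup>2 \<le> (norm ((1 - t) *\<^sub>R p + t *\<^sub>R q - w))\<^sup>2"
      by (simp add: power_mono)
    then have "t * (2 * ((w - p) \<bullet> (q - p))) \<le> t * (t * (norm (q - p))\<^sup>2)"
      by (simp add: power2_norm_eq_inner inner_simps inner_commute algebra_simps)
    then show ?thesis using t by simp
  qed
  have "2 * ((w - p) \<bullet> (q - p)) \<le> (1 / Suc n) * (norm (q - p))\<^sup>2" for n
    using small[of "1 / Suc n"] by simp
  moreover have "(\<lambda>n. (1 / Suc n) * (norm (q - p))\<^sup>2) \<longlonglongrightarrow> 0 * (norm (q - p))\<^sup>2"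
    by (intro tendsto_intros LIMSEQ_Suc[OF lim_1_over_n])
  ultimately have "2 * ((w - p) \<bullet> (q - p)) \<le> 0 * (norm (q - p))\<^sup>2"
    by (intro LIMSEQ_le_const) auto
  then show "(w - p) \<bullet> (q - p) \<le> 0" by simp
next
  assume p: "p \<in> C" and var: "\<forall>q\<in>C. (w - p) \<bullet> (q - p) \<le> 0"
  have "norm (p - w) \<le> norm (q - w)" if "q \<in> C" for q
  proof -
    have "(norm (q - w))\<^sup>2 = (norm (p - w))\<^sup>2 - 2 * ((w - p) \<bullet> (q - p)) + (norm (q - p))\<^sup>2"
      by (simp add: power2_norm_eq_inner inner_simps inner_commute algebra_simps)
    then have "(norm (p - w))\<^sup>2 \<le> (norm (q - w))\<^sup>2"
      using var that by (smt (verit) zero_le_power2)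
    then show ?thesis by (rule power2_le_imp_le) simp
  qed
  then show "is_arg_min (\<lambda>q. norm (q - w)) (\<lambda>q. q \<in> C) p"
    using p by (auto simp: is_arg_min_linorder)
qed

lemma proj_eqI:
  fixes C :: "'a::real_inner set"
  assumes C: "convex C" and p: "p \<in> C" "\<And>q. q \<in> C \<Longrightarrow> (w - p) \<bullet> (q - p) \<le> 0"
  shows "proj C w = p"
  unfolding proj_def
proof (rule the_equality)
  show "is_arg_min (\<lambda>q. norm (q - w)) (\<lambda>q. q \<in> C) p"
    using p by (simp add: is_arg_min_norm_iff[OF C])
next
  fix p' assume "is_arg_min (\<lambda>q. norm (q - w)) (\<lambda>q. q \<in> C) p'"
  then have "p' \<in> C" "(w - p') \<bullet> (p - p') \<le> 0"
    using p by (auto simp: is_arg_min_norm_iff[OF C])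
  then have "(norm (p - p'))\<^sup>2 \<le> 0"
    using p(2)[of p'] by (simp add: power2_norm_eq_inner inner_simps inner_commute)
  then show "p' = p" by simp
qed

text \<open>
  Minimising \<open>\<parallel>v\<parallel>\<^sup>2\<close> over the translate \<open>C - w\<close>; here the minimising sequence itself converges, and
  closedness of \<open>C\<close> puts its limit into the set.
\<close>
lemma proj_Hilbert:
  fixes C :: "'a::{real_inner, complete_space} set"
  assumes C: "convex C" "closed C" "C \<noteq> {}"
  shows proj_in: "proj C w \<in> C"
    and proj_variational: "q \<in> C \<Longrightarrow> (w - proj C w) \<bullet> (q - proj C w) \<le> 0"
proof -
  define S where "S = (\<lambda>q. q - w) ` C \<times> {0::real}"
  have S: "convex S" unfolding S_def
    by (intro convex_Times convex_singleton) (use C(1) in \<open>simp add: convex_translation_subtract_eq\<close>)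
  have S_ne: "S \<noteq> {}" using C by (auto simp: S_def)
  have S_ge: "0 \<le> (norm v)\<^sup>2 + d" if "(v, d) \<in> S" for v d
    using that by (auto simp: S_def)
  obtain s u e v where "0 \<le> s" and uS: "\<And>n. (u n, e n) \<in> S" and u: "u \<longlonglongrightarrow> v"
    and s: "(\<lambda>n. (norm (u n))\<^sup>2 + e n) \<longlonglongrightarrow> s"
    and var: "\<And>w d. (w, d) \<in> S \<Longrightarrow> (norm v)\<^sup>2 + s \<le> 2 * (v \<bullet> w) + d"
    by (rule convex_quadratic_infimum[OF S S_ne], erule S_ge) (rule that)
  have uC: "u n + w \<in> C" "e n = 0" for n
    using uS[of n] by (auto simp: S_def)
  have "(\<lambda>n. u n + w) \<longlonglongrightarrow> v + w" by (intro tendsto_intros u)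
  then have vC: "v + w \<in> C"
    by (rule closed_sequentially[OF C(2) uC(1)])
  have "(\<lambda>n. (norm (u n))\<^sup>2 + e n) \<longlonglongrightarrow> (norm v)\<^sup>2"
    unfolding uC(2) add_0_right by (intro tendsto_intros u)
  then have "s = (norm v)\<^sup>2" using s LIMSEQ_unique by blast
  then have "(w - (v + w)) \<bullet> (q - (v + w)) \<le> 0" if "q \<in> C" for q
    using var[of "q - w" 0] that
    by (auto simp: S_def power2_norm_eq_inner inner_simps inner_commute)
  moreover from this have "proj C w = v + w"
    using C(1) vC by (intro proj_eqI) auto
  ultimately show "proj C w \<in> C" "q \<in> C \<Longrightarrow> (w - proj C w) \<bullet> (q - proj C w) \<le> 0"
    using vC by auto
qed

lemma is_arg_min_norm_iff_proj:
  fixes C :: "'a::{real_inner, complete_space} set"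
  assumes "convex C" "closed C" "C \<noteq> {}"
  shows "is_arg_min (\<lambda>q. norm (q - w)) (\<lambda>q. q \<in> C) p \<longleftrightarrow> p = proj C w"
  using assms proj_in proj_variational proj_eqI[of C p w] is_arg_min_norm_iff[of C w]
  by metis

lemma proj_scaleR:
  fixes C :: "'a::{real_inner, complete_space} set"
  assumes C: "convex C" "closed C" "C \<noteq> {}"
  shows "proj ((*\<^sub>R) c ` C) (c *\<^sub>R w) = c *\<^sub>R proj C w"
proof (rule proj_eqI)
  show "convex ((*\<^sub>R) c ` C)" using C(1) by (rule convex_scaling)
  show "c *\<^sub>R proj C w \<in> (*\<^sub>R) c ` C" using proj_in[OF C] by blast
  fix q assume "q \<in> (*\<^sub>R) c ` C"
  then obtain r where r: "r \<in> C" "q = c *\<^sub>R r" by blast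
  have "(c *\<^sub>R w - c *\<^sub>R proj C w) \<bullet> (q - c *\<^sub>R proj C w)
      = (c * c) * ((w - proj C w) \<bullet> (r - proj C w))"
    by (simp add: r flip: scaleR_diff_right)
  also have "\<dots> \<le> 0"
    using proj_variational[OF C r(1)] by (intro mult_nonneg_nonpos) auto
  finally show "(c *\<^sub>R w - c *\<^sub>R proj C w) \<bullet> (q - c *\<^sub>R proj C w) \<le> 0" .
qed

text \<open>
  The infimum of \<open>\<parallel>v\<parallel>\<^sup>2 - 2 f v\<close> over the whole space is finite because \<open>f\<close> is bounded. The first-order
  condition then bounds the linear functional \<open>\<lambda>x. v \<bullet> x - f x\<close> from below, so it vanishes.
\<close>
lemma Riesz_representation:
  fixes f :: "'a::{real_inner, complete_space} \<Rightarrow> real"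
  assumes "bounded_linear f"
  obtains a where "\<And>x. f x = a \<bullet> x"
proof -
  interpret f: bounded_linear f by fact
  obtain k where k: "\<And>x. norm (f x) \<le> norm x * k" using f.bounded by blast
  define S where "S = range (\<lambda>x. (x, - 2 * f x))"
  have "linear (\<lambda>x. (x, - 2 * f x))"
    by (intro linearI) (auto simp: f.add f.scaleR algebra_simps)
  then have S: "convex S" unfolding S_def by (intro convex_linear_image) auto
  have S_ne: "S \<noteq> {}" by (auto simp: S_def)
  have S_ge: "- k\<^sup>2 \<le> (norm v)\<^sup>2 + d" if "(v, d) \<in> S" for v d
  proof -
    have "d = - 2 * f v" using that by (auto simp: S_def)
    moreover have "0 \<le> (norm v - k)\<^sup>2" by simp
    ultimately show ?thesis
      using k[of v] by (simp add: power2_diff)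
  qed
  obtain v s
    where var: "\<And>w d. (w, d) \<in> S \<Longrightarrow> (norm v)\<^sup>2 + s \<le> 2 * (v \<bullet> w) + d"
    by (rule convex_quadratic_infimum[OF S S_ne], erule S_ge) (rule that)
  have bd: "(norm v)\<^sup>2 + s \<le> 2 * (v \<bullet> x - f x)" for x
    using var[of x "- 2 * f x"] by (simp add: S_def)
  have "f x = v \<bullet> x" for x
  proof (rule ccontr)
    define c where "c = v \<bullet> x - f x"
    assume "f x \<noteq> v \<bullet> x"
    then have "c \<noteq> 0" by (simp add: c_def)
    \<comment> \<open>at \<open>t *\<^sub>R x\<close> twice the functional equals the lower bound minus 1\<close>
    define t where "t = ((norm v)\<^sup>2 + s - 1) / (2 * c)"
    have "(norm v)\<^sup>2 + s \<le> 2 * (t * c)"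
      using bd[of "t *\<^sub>R x"] by (simp add: c_def f.scaleR algebra_simps)
    then show False using \<open>c \<noteq> 0\<close> by (simp add: t_def)
  qed
  then show thesis by (rule that)
qed

text \<open>
  The constant \<open>adjoint\<close> is a choice among functions with the adjoint property; the Riesz
  representation supplies one.
\<close>
lemma adjoint_Hilbert:
  fixes L :: "'a::{real_inner, complete_space} \<Rightarrow> 'b::real_inner"
  assumes "bounded_linear L"
  shows "L x \<bullet> y = x \<bullet> adjoint L y"
proof -
  have "\<exists>a. \<forall>x. L x \<bullet> y = x \<bullet> a" for y
  proof -
    have "bounded_linear (\<lambda>x. L x \<bullet> y)"
      by (intro bounded_linear_inner_left_comp assms)
    from Riesz_representation[OF this] show ?thesis
      by (metis inner_commute)
  qed
  then obtain g where "\<forall>x y. L x \<bullet> y = x \<bullet> g y" by metis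
  moreover from this have "adjoint L = g" by (rule adjoint_unique)
  ultimately show ?thesis by simp
qed

lemma bounded_linear_adjoint:
  fixes L :: "'a::{real_inner, complete_space} \<Rightarrow> 'b::real_inner"
  assumes "bounded_linear L"
  shows "bounded_linear (adjoint L)"
proof -
  note adj = adjoint_Hilbert[OF assms]
  obtain k where k: "k > 0" "\<And>x. norm (L x) \<le> norm x * k"
    using bounded_linear.pos_bounded[OF assms] by blast
  have eqI: "a = b" if "\<And>x. x \<bullet> a = x \<bullet> b" for a b :: 'a
    using that[of "a - b"] inner_eq_zero_iff[of "a - b"] by (simp add: inner_diff_right)
  show ?thesis
  proof (rule bounded_linear_intro[where K = k])
    show "adjoint L (y + z) = adjoint L y + adjoint L z" for y z
      by (rule eqI) (simp add: inner_add_right flip: adj)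
    show "adjoint L (r *\<^sub>R y) = r *\<^sub>R adjoint L y" for r y
      by (rule eqI) (simp flip: adj)
    show "norm (adjoint L y) \<le> norm y * k" for y
    proof (cases "adjoint L y = 0")
      case False
      have "norm (adjoint L y) * norm (adjoint L y) = L (adjoint L y) \<bullet> y"
        by (simp add: adj flip: power2_norm_eq_inner power2_eq_square)
      also have "\<dots> \<le> norm (L (adjoint L y)) * norm y" by (rule norm_cauchy_schwarz)
      also have "\<dots> \<le> norm (adjoint L y) * k * norm y" by (intro mult_right_mono k) auto
      finally show ?thesis using False by (simp add: mult.assoc mult.commute)
    qed (use k in simp)
  qed
qed

section \<open>Maximally monotone operators and Minty's theorem\<close>

text \<open>
  Adding to the graph a point that is monotonically related to all of it preserves monotonicity, so by
  maximality the point was already there.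
\<close>
lemma maximally_monotone_memI:
  fixes N :: "'a::real_inner \<Rightarrow> 'a set"
  assumes N: "maximally_monotone N"
    and rel: "\<And>a b. b \<in> N a \<Longrightarrow> 0 \<le> (a - x) \<bullet> (b - u)"
  shows "u \<in> N x"
proof -
  define N' where "N' = N(x := insert u (N x))"
  have mono: "0 \<le> (a - a') \<bullet> (b - b')" if "b \<in> N a" "b' \<in> N a'" for a b a' b'
    using N that by (auto simp: maximally_monotone_def monotone_op_def)
  have rel': "0 \<le> (x - a) \<bullet> (u - b)" if "b \<in> N a" for a b
    using rel[OF that] by (simp add: inner_simps)
  have "monotone_op N'"
    unfolding monotone_op_def N'_def using mono rel rel' by (auto split: if_splits)
  moreover have "N a \<subseteq> N' a" for a by (auto simp: N'_def)
  ultimately have "N' = N" using N by (auto simp: maximally_monotone_def)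
  then show ?thesis by (metis N'_def fun_upd_same insertI1)
qed

lemma maximally_monotone_mem_iff:
  fixes N :: "'a::real_inner \<Rightarrow> 'a set"
  assumes "maximally_monotone N"
  shows "u \<in> N x \<longleftrightarrow> (\<forall>a b. b \<in> N a \<longrightarrow> 0 \<le> (a - x) \<bullet> (b - u))"
proof
  assume "u \<in> N x"
  with assms show "\<forall>a b. b \<in> N a \<longrightarrow> 0 \<le> (a - x) \<bullet> (b - u)"
    by (auto simp: maximally_monotone_def monotone_op_def)
qed (use maximally_monotone_memI[OF assms] in blast)

lemma maximally_monotoneI:
  fixes N :: "'a::real_inner \<Rightarrow> 'a set"
  assumes "monotone_op N"
    and "\<And>x u. (\<And>a b. b \<in> N a \<Longrightarrow> 0 \<le> (a - x) \<bullet> (b - u)) \<Longrightarrow> u \<in> N x"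
  shows "maximally_monotone N"
  unfolding maximally_monotone_def
proof (intro conjI allI impI ext equalityI subsetI; (elim conjE)?)
  fix N' x u assume N': "monotone_op N'" "\<forall>x. N x \<subseteq> N' x" and u: "u \<in> N' x"
  show "u \<in> N x"
    by (rule assms(2)) (use N' u in \<open>unfold monotone_op_def, blast\<close>)
qed (use assms in auto)

lemma maximally_monotone_op_inverse:
  fixes N :: "'a::real_inner \<Rightarrow> 'a set"
  assumes "maximally_monotone N"
  shows "maximally_monotone (op_inverse N)"
proof (rule maximally_monotoneI)
  show "monotone_op (op_inverse N)"
    unfolding monotone_op_def op_inverse_def
  proof safe
    fix x y u v assume "x \<in> N u" "y \<in> N v"
    then have "0 \<le> (u - v) \<bullet> (x - y)"
      using assms by (simp add: maximally_monotone_def monotone_op_def)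
    then show "0 \<le> (x - y) \<bullet> (u - v)" by (simp add: inner_commute)
  qed
  show "u \<in> op_inverse N x"
    if "\<And>a b. b \<in> op_inverse N a \<Longrightarrow> 0 \<le> (a - x) \<bullet> (b - u)" for x u
  proof -
    have "x \<in> N u"
    proof (rule maximally_monotone_memI[OF assms])
      fix a b assume "b \<in> N a"
      then have "0 \<le> (b - x) \<bullet> (a - u)" by (intro that) (simp add: op_inverse_def)
      then show "0 \<le> (a - u) \<bullet> (b - x)" by (simp add: inner_commute)
    qed
    then show ?thesis by (simp add: op_inverse_def)
  qed
qed

lemma scale_op_mem_iff:
  assumes "\<gamma> \<noteq> 0"
  shows "u \<in> scale_op \<gamma> N x \<longleftrightarrow> (1 / \<gamma>) *\<^sub>R u \<in> N x"
  using assms by (auto simp: scale_op_def image_iff intro!: bexI[of _ "(1 / \<gamma>) *\<^sub>R u"])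

lemma maximally_monotone_scale_op:
  fixes N :: "'a::real_inner \<Rightarrow> 'a set"
  assumes N: "maximally_monotone N" and \<gamma>: "\<gamma> > 0"
  shows "maximally_monotone (scale_op \<gamma> N)"
proof (rule maximally_monotoneI)
  show "monotone_op (scale_op \<gamma> N)"
    unfolding monotone_op_def scale_op_def
  proof safe
    fix x y u v assume "u \<in> N x" "v \<in> N y"
    then have "0 \<le> \<gamma> * ((x - y) \<bullet> (u - v))"
      using N \<gamma> by (simp add: maximally_monotone_def monotone_op_def)
    also have "\<dots> = (x - y) \<bullet> (\<gamma> *\<^sub>R u - \<gamma> *\<^sub>R v)"
      by (simp flip: scaleR_diff_right)
    finally show "0 \<le> (x - y) \<bullet> (\<gamma> *\<^sub>R u - \<gamma> *\<^sub>R v)" .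
  qed
  fix x u
  assume rel: "\<And>a b. b \<in> scale_op \<gamma> N a \<Longrightarrow> 0 \<le> (a - x) \<bullet> (b - u)"
  have "(1 / \<gamma>) *\<^sub>R u \<in> N x"
  proof (rule maximally_monotone_memI[OF N])
    fix a b assume "b \<in> N a"
    then have "0 \<le> (a - x) \<bullet> (\<gamma> *\<^sub>R b - u)"
      by (intro rel) (auto simp: scale_op_def)
    also have "\<gamma> *\<^sub>R b - u = \<gamma> *\<^sub>R (b - (1 / \<gamma>) *\<^sub>R u)"
      using \<gamma> by (simp add: scaleR_diff_right)
    finally show "0 \<le> (a - x) \<bullet> (b - (1 / \<gamma>) *\<^sub>R u)"
      using \<gamma> by (simp add: zero_le_mult_iff)
  qed
  then show "u \<in> scale_op \<gamma> N x" using \<gamma> by (simp add: scale_op_mem_iff)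
qed

text \<open>
  For fixed \<open>x\<close>, being monotonically related to each point of the graph cuts out a closed halfspace of
  values \<open>u\<close>.
\<close>
lemma closed_convex_maximally_monotone:
  fixes N :: "'a::real_inner \<Rightarrow> 'a set"
  assumes "maximally_monotone N"
  shows "closed (N x)" "convex (N x)"
proof -
  have "N x = (\<Inter>p\<in>{(a, b). b \<in> N a}. {u. (fst p - x) \<bullet> u \<le> (fst p - x) \<bullet> snd p})"
    using maximally_monotone_mem_iff[OF assms, of _ x]
    by (auto simp: inner_diff_right)
  then show "closed (N x)" "convex (N x)"
    by (simp_all add: closed_INT closed_halfspace_le convex_INT convex_halfspace_le)
qed

text \<open>
  This is the existence half of Minty's theorem. The condition on \<open>x\<close> reads
  \<open>\<parallel>x\<parallel>\<^sup>2 \<le> 2 (x \<bullet> w) + a \<bullet> b\<close> with \<open>w = (a - b)/2\<close>, which is the first-order condition of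
  \<open>convex_quadratic_infimum\<close> for the convex hull of the pairs \<open>(w, a \<bullet> b)\<close>, provided that the infimum is
  nonnegative. Monotonicity guarantees this: a convex combination \<open>(a, b, d)\<close> of the triples
  \<open>(a, b, a \<bullet> b)\<close> satisfies \<open>a \<bullet> b \<le> d\<close>, and therefore
  \<open>\<parallel>(a - b)/2\<parallel>\<^sup>2 + d \<ge> \<parallel>(a + b)/2\<parallel>\<^sup>2 \<ge> 0\<close>.
\<close>
lemma monotone_related_antidiagonal:
  fixes G :: "('a::{real_inner, complete_space} \<times> 'a) set"
  assumes G: "\<And>a b a' b'. (a, b) \<in> G \<Longrightarrow> (a', b') \<in> G \<Longrightarrow> 0 \<le> (a - a') \<bullet> (b - b')"
  obtains x where "\<And>a b. (a, b) \<in> G \<Longrightarrow> 0 \<le> (a - x) \<bullet> (b + x)"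
proof (cases "G = {}")
  case False
  define H where "H = convex hull ((\<lambda>(a, b). (a, b, a \<bullet> b)) ` G)"
  have halfspace: "0 \<le> d - a \<bullet> \<beta> - \<alpha> \<bullet> b + \<delta>"
    if p: "(a, b, d) \<in> H" and q: "\<And>a b. (a, b) \<in> G \<Longrightarrow> 0 \<le> a \<bullet> b - a \<bullet> \<beta> - \<alpha> \<bullet> b + \<delta>"
    for a b d and \<alpha> \<beta> :: 'a and \<delta>
  proof -
    have "H \<subseteq> {p. (\<beta>, \<alpha>, - 1) \<bullet> p \<le> \<delta>}"
      unfolding H_def
    proof (rule hull_minimal)
      show "(\<lambda>(a, b). (a, b, a \<bullet> b)) ` G \<subseteq> {p. (\<beta>, \<alpha>, - 1) \<bullet> p \<le> \<delta>}"
        using q by (fastforce simp: inner_commute)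
    qed (rule convex_halfspace_le)
    then show ?thesis using p by (auto simp: inner_commute)
  qed
  \<comment> \<open>an inequality affine in each of two triples separately extends from the graph to its hull,
     one triple at a time; on the diagonal it is the claim\<close>
  have hull: "a \<bullet> b \<le> d" if p: "(a, b, d) \<in> H" for a b d
  proof -
    have "0 \<le> d - a \<bullet> b' - a' \<bullet> b + a' \<bullet> b'" if "(a', b') \<in> G" for a' b'
      by (rule halfspace[OF p]) (use G[OF _ that] in \<open>simp add: inner_simps algebra_simps\<close>)
    then have "0 \<le> d - a \<bullet> b - a \<bullet> b + d"
      by (intro halfspace[OF p]) (simp add: algebra_simps)
    then show ?thesis by simp
  qed
  define f :: "'a \<times> 'a \<times> real \<Rightarrow> 'a \<times> real"
    where "f = (\<lambda>(a, b, d). ((1/2) *\<^sub>R (a - b), d))"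
  have "linear f" by (intro linearI) (auto simp: f_def algebra_simps)
  then have S: "convex (f ` H)" unfolding H_def by (intro convex_linear_image) auto
  have S_ne: "f ` H \<noteq> {}" using False by (simp add: H_def)
  have S_ge: "0 \<le> (norm v)\<^sup>2 + d" if vd: "(v, d) \<in> f ` H" for v d
  proof -
    obtain a b where ab: "(a, b, d) \<in> H" "v = (1/2) *\<^sub>R (a - b)"
      using vd unfolding f_def by auto
    have "(norm v)\<^sup>2 + a \<bullet> b = (norm ((1/2) *\<^sub>R (a + b)))\<^sup>2"
      by (simp only: ab power2_norm_eq_inner) (simp add: inner_simps inner_commute field_simps)
    then show ?thesis using hull[OF ab(1)] by (smt (verit) zero_le_power2)
  qed
  obtain v s where "0 \<le> s"
    and var: "\<And>w d. (w, d) \<in> f ` H \<Longrightarrow> (norm v)\<^sup>2 + s \<le> 2 * (v \<bullet> w) + d"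
    by (rule convex_quadratic_infimum[OF S S_ne], erule S_ge) (rule that)
  have "0 \<le> (a - v) \<bullet> (b + v)" if "(a, b) \<in> G" for a b
  proof -
    have "(a, b, a \<bullet> b) \<in> H"
      unfolding H_def by (rule hull_inc) (use that in force)
    then have "((1/2) *\<^sub>R (a - b), a \<bullet> b) \<in> f ` H"
      by (force simp: f_def)
    from var[OF this] \<open>0 \<le> s\<close> show ?thesis
      by (simp add: power2_norm_eq_inner inner_simps inner_commute algebra_simps)
  qed
  then show thesis by (rule that)
qed (use that in blast)

text \<open>
  Shifting the values of \<open>N\<close> by \<open>z\<close> reduces surjectivity to the antidiagonal case.
\<close>
theorem Minty:
  fixes N :: "'a::{real_inner, complete_space} \<Rightarrow> 'a set"
  assumes N: "maximally_monotone N"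
  shows "\<exists>!p. z - p \<in> N p"
proof (rule ex_ex1I)
  define G where "G = {(a, b - z) | a b. b \<in> N a}"
  have "0 \<le> (a - a') \<bullet> (b - b')" if "(a, b) \<in> G" "(a', b') \<in> G" for a b a' b'
    using that N by (auto simp: G_def maximally_monotone_def monotone_op_def)
  then obtain x where x: "\<And>a b. (a, b) \<in> G \<Longrightarrow> 0 \<le> (a - x) \<bullet> (b + x)"
    using monotone_related_antidiagonal[of G] by blast
  have "z - x \<in> N x"
  proof (rule maximally_monotone_memI[OF N])
    fix a b assume "b \<in> N a"
    then have "(a, b - z) \<in> G" by (auto simp: G_def)
    from x[OF this] show "0 \<le> (a - x) \<bullet> (b - (z - x))" by (simp add: algebra_simps)
  qed
  then show "\<exists>p. z - p \<in> N p" ..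
next
  fix p q assume "z - p \<in> N p" "z - q \<in> N q"
  then have "0 \<le> (p - q) \<bullet> ((z - p) - (z - q))"
    using N unfolding maximally_monotone_def monotone_op_def by blast
  also have "\<dots> = - (norm (p - q))\<^sup>2"
    by (simp add: power2_norm_eq_inner inner_simps inner_commute)
  finally show "p = q" by simp
qed

lemma op_inverse_add_mem_iff:
  fixes N :: "'a::ab_group_add \<Rightarrow> 'a set"
  shows "p \<in> op_inverse (\<lambda>p. {p} + N p) z \<longleftrightarrow> z - p \<in> N p"
proof -
  have "z = p + n \<longleftrightarrow> n = z - p" for n by auto
  then show ?thesis by (simp add: op_inverse_def set_plus_def)
qed

lemma the_elem_eq_iff:
  assumes "\<exists>!p. p \<in> S"
  shows "the_elem S = p \<longleftrightarrow> p \<in> S"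
proof -
  obtain q where "S = {q}" using assms by blast
  then show ?thesis by auto
qed

text \<open>
  Since \<open>the_elem\<close> is unspecified off singletons, a value of the resolvent carries information only
  because Minty's theorem makes the underlying set a singleton.
\<close>
lemma resolvent_eq_iff:
  fixes N :: "'a::{real_inner, complete_space} \<Rightarrow> 'a set"
  assumes "maximally_monotone N" "\<gamma> > 0"
  shows "resolvent (scale_op \<gamma> N) z = p \<longleftrightarrow> (1 / \<gamma>) *\<^sub>R (z - p) \<in> N p"
proof -
  have "\<exists>!p. z - p \<in> scale_op \<gamma> N p"
    by (intro Minty maximally_monotone_scale_op assms)
  then show ?thesis
    unfolding resolvent_def using assms(2)
    by (subst the_elem_eq_iff) (simp_all add: op_inverse_add_mem_iff scale_op_mem_iff)
qed

section \<open>Primal-dual solution pairs\<close>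

text \<open>
  The zeros of the block operator, that is, the Karush-Kuhn-Tucker pairs.
\<close>
definition kkt ::
  "('x::real_inner \<Rightarrow> 'x set) \<Rightarrow> ('y::real_inner \<Rightarrow> 'y set) \<Rightarrow> ('x \<Rightarrow> 'y) \<Rightarrow> ('x \<times> 'y) set" where
  "kkt A B L = {(x, y). - adjoint L y \<in> A x \<and> y \<in> B (L x)}"

lemma primal_solutions_eq: "primal_solutions A B L = fst ` kkt A B L"
proof -
  have "0 = a + b \<longleftrightarrow> a = - b" for a b :: 'a
    by (metis eq_neg_iff_add_eq_0)
  then show ?thesis
    by (force simp: primal_solutions_def kkt_def set_plus_def image_iff)
qed

lemma dual_solutions_eq: "dual_solutions A B L = snd ` kkt A B L"
  by (force simp: dual_solutions_def kkt_def op_inverse_def image_iff)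

locale primal_dual_pair =
  fixes A :: "'x::{real_inner, complete_space} \<Rightarrow> 'x set"
    and B :: "'y::{real_inner, complete_space} \<Rightarrow> 'y set"
    and L :: "'x \<Rightarrow> 'y"
  assumes L: "bounded_linear L"
    and A: "maximally_monotone A"
    and B: "maximally_monotone B"
    and A_para: "paramonotone A"
    and B_para: "paramonotone B"
begin

sublocale L: bounded_linear L by (rule L)
sublocale Ladj: bounded_linear "adjoint L" by (rule bounded_linear_adjoint[OF L])

lemmas adj = adjoint_Hilbert[OF L]

abbreviation (input) Z where "Z \<equiv> primal_solutions A B L"
abbreviation (input) K where "K \<equiv> dual_solutions A B L"

text \<open>
  The two inner products are equal by adjointness. Monotonicity of \<open>A\<close> makes their common value at
  most 0, and monotonicity of \<open>B\<close> makes it at least 0.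
\<close>
lemma kkt_inner_zero:
  assumes p: "(x, y) \<in> kkt A B L" and q: "(x', y') \<in> kkt A B L"
  shows "(x - x') \<bullet> (adjoint L y - adjoint L y') = 0"
    and "(L x - L x') \<bullet> (y - y') = 0"
proof -
  have "0 \<le> (x - x') \<bullet> (- adjoint L y - - adjoint L y')"
    using A p q unfolding maximally_monotone_def monotone_op_def kkt_def by blast
  moreover have "0 \<le> (L x - L x') \<bullet> (y - y')"
    using B p q unfolding maximally_monotone_def monotone_op_def kkt_def by blast
  moreover have "(L x - L x') \<bullet> (y - y') = (x - x') \<bullet> (adjoint L y - adjoint L y')"
    by (simp add: adj flip: L.diff Ladj.diff)
  ultimately show "(x - x') \<bullet> (adjoint L y - adjoint L y') = 0"
    "(L x - L x') \<bullet> (y - y') = 0"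
    by (simp_all add: inner_simps)
qed

lemma kkt_exchange:
  assumes p: "(x, y) \<in> kkt A B L" and q: "(x', y') \<in> kkt A B L"
  shows "(x, y') \<in> kkt A B L"
proof -
  have "(x - x') \<bullet> (- adjoint L y - - adjoint L y') = 0"
    using kkt_inner_zero(1)[OF p q] by (simp add: inner_simps)
  then have "- adjoint L y' \<in> A x"
    using A_para p q unfolding paramonotone_def kkt_def by blast
  moreover have "y' \<in> B (L x)"
    using B_para p q kkt_inner_zero(2)[OF p q] unfolding paramonotone_def kkt_def by blast
  ultimately show ?thesis by (simp add: kkt_def)
qed

lemma kkt_eq_Times: "kkt A B L = Z \<times> K"
  unfolding primal_solutions_eq dual_solutions_eq by (force intro: kkt_exchange)

lemma solutions_orthogonal:
  assumes "z \<in> Z" "z' \<in> Z" "k \<in> K" "k' \<in> K"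
  shows "(z - z') \<bullet> (adjoint L k - adjoint L k') = 0"
  using assms by (intro kkt_inner_zero(1)) (auto simp: kkt_eq_Times)

text \<open>
  Because the pairs form a product, one fixed dual solution \<open>k\<close> serves as the partner of every primal
  solution, which exhibits \<open>Z\<close> as an intersection of preimages of values of the maximally monotone operators
  \<open>A\<^sup>-\<^sup>1\<close> and \<open>B\<^sup>-\<^sup>1\<close>. The dual case is analogous.
\<close>
lemma closed_convex_primal_solutions: "closed Z" "convex Z"
proof -
  have "closed Z \<and> convex Z"
  proof (cases "K = {}")
    case True
    then have "Z = {}" by (simp add: primal_solutions_eq dual_solutions_eq)
    then show ?thesis by simp
  next
    case False
    then obtain k where k: "k \<in> K" by blast
    have "z \<in> Z \<longleftrightarrow> (z, k) \<in> kkt A B L" for z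
      using k by (simp add: kkt_eq_Times)
    then have "Z = op_inverse A (- adjoint L k) \<inter> L -` op_inverse B k"
      by (auto simp: kkt_def op_inverse_def)
    moreover have "closed (L -` op_inverse B k)"
      by (intro closed_vimage closed_convex_maximally_monotone(1)
          maximally_monotone_op_inverse B L.continuous_on continuous_on_id)
    moreover have "convex (L -` op_inverse B k)"
      by (intro convex_linear_vimage L.linear_axioms closed_convex_maximally_monotone(2)
          maximally_monotone_op_inverse B)
    ultimately show ?thesis
      by (simp add: closed_Int convex_Int closed_convex_maximally_monotone
          maximally_monotone_op_inverse A)
  qed
  then show "closed Z" "convex Z" by auto
qed

lemma closed_convex_dual_solutions: "closed K" "convex K"
proof -
  have "closed K \<and> convex K"
  proof (cases "Z = {}")
    case True
    then have "K = {}" by (simp add: primal_solutions_eq dual_solutions_eq)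
    then show ?thesis by simp
  next
    case False
    then obtain z where z: "z \<in> Z" by blast
    have "k \<in> K \<longleftrightarrow> (z, k) \<in> kkt A B L" for k
      using z by (simp add: kkt_eq_Times)
    then have "K = (\<lambda>y. - adjoint L y) -` A z \<inter> B (L z)"
      by (auto simp: kkt_def)
    moreover have "closed ((\<lambda>y. - adjoint L y) -` A z)"
      by (intro closed_vimage closed_convex_maximally_monotone(1) A
          continuous_on_minus Ladj.continuous_on continuous_on_id)
    moreover have "linear (\<lambda>y. - adjoint L y)"
      by (intro linear_compose_neg Ladj.linear_axioms)
    then have "convex ((\<lambda>y. - adjoint L y) -` A z)"
      by (rule convex_linear_vimage) (rule closed_convex_maximally_monotone(2)[OF A])
    ultimately show ?thesis
      by (simp add: closed_Int convex_Int closed_convex_maximally_monotone B)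
  qed
  then show "closed K" "convex K" by auto
qed

end

section \<open>The Chambolle-Pock operator with a coisometric scaling\<close>

locale coisometric_chambolle_pock = primal_dual_pair A B L
  for A :: "'x::{real_inner, complete_space} \<Rightarrow> 'x set"
    and B :: "'y::{real_inner, complete_space} \<Rightarrow> 'y set"
    and L :: "'x \<Rightarrow> 'y" +
  fixes \<sigma> \<tau> :: real
  assumes \<sigma>: "\<sigma> > 0" and \<tau>: "\<tau> > 0"
    and coisometry: "(\<sigma> * \<tau>) *\<^sub>R L (adjoint L y) = y"
begin

text \<open>
  Up to the factor \<open>1 / sqrt \<sigma>\<close> this is the adjoint of \<open>CP_factor\<close> (see \<open>adjoint_CP_factor\<close>): the part of
  a pair which the preconditioner sees, and on which the primal step depends.
\<close>
definition shadow :: "'x \<times> 'y \<Rightarrow> 'x" where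
  "shadow = (\<lambda>(x, y). x - \<sigma> *\<^sub>R adjoint L y)"

lemma linear_shadow: "linear shadow"
  by (intro linearI) (auto simp: shadow_def Ladj.add Ladj.scaleR algebra_simps)

text \<open>
  The coisometry assumption makes \<open>\<tau> L\<close> a left inverse of \<open>\<sigma> L\<^sup>*\<close>, so \<open>y\<close> can be recovered
  from its contribution to the shadow.
\<close>
lemma dual_from_shadow: "y = \<tau> *\<^sub>R L (x - shadow (x, y))"
  using coisometry[of y] by (simp add: shadow_def L.scaleR mult.commute)

lemma primal_step_fixed_iff:
  "resolvent (scale_op \<sigma> A) (shadow (x, y)) = x \<longleftrightarrow> - adjoint L y \<in> A x"
  using \<sigma> by (simp add: resolvent_eq_iff[OF A \<sigma>] shadow_def)

lemma dual_step_fixed_iff: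
  "resolvent (scale_op \<tau> (op_inverse B)) (y + \<tau> *\<^sub>R L x) = y \<longleftrightarrow> y \<in> B (L x)"
  using \<tau> by (simp add: resolvent_eq_iff[OF maximally_monotone_op_inverse[OF B] \<tau>] op_inverse_def)

text \<open>
  The dual step can be computed from the new primal point and the shadow of the old pair. This is what
  allows the iteration to be carried out on shadows alone, and where the dual part of the
  \<open>M\<close>-projection comes from.
\<close>
lemma dual_step_argument:
  "y + \<tau> *\<^sub>R L x = (2 * \<tau>) *\<^sub>R L x - \<tau> *\<^sub>R L (shadow (x, y))"
proof -
  have "(2 * \<tau>) *\<^sub>R L x = \<tau> *\<^sub>R L x + \<tau> *\<^sub>R L x"
    by (simp flip: scaleR_add_left)
  then show ?thesis
    using dual_from_shadow[of y x] by (simp add: L.diff scaleR_diff_right)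
qed

lemma Fix_CP_op: "Fix (CP_op A B L \<sigma> \<tau>) = kkt A B L"
proof -
  have "CP_op A B L \<sigma> \<tau> (x, y) = (x, y) \<longleftrightarrow> (x, y) \<in> kkt A B L" for x y
  proof -
    have "2 *\<^sub>R x - x = x" by (simp add: scaleR_2)
    then have "CP_op A B L \<sigma> \<tau> (x, y) = (x, y) \<longleftrightarrow>
        resolvent (scale_op \<sigma> A) (shadow (x, y)) = x \<and>
        resolvent (scale_op \<tau> (op_inverse B)) (y + \<tau> *\<^sub>R L x) = y"
      by (auto simp: CP_op_def Let_def shadow_def)
    then show ?thesis
      by (simp add: primal_step_fixed_iff dual_step_fixed_iff kkt_def)
  qed
  then show ?thesis by (auto simp: Fix_def)
qed

lemma adjoint_CP_factor: "adjoint (CP_factor L \<sigma>) p = (1 / sqrt \<sigma>) *\<^sub>R shadow p"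
proof -
  have sq: "\<sigma> * c / sqrt \<sigma> = sqrt \<sigma> * c" for c
    using \<sigma> by (metis less_imp_le real_div_sqrt times_divide_eq_left)
  have "CP_factor L \<sigma> x \<bullet> (a, b) = x \<bullet> ((1 / sqrt \<sigma>) *\<^sub>R shadow (a, b))" for x a b
    by (simp add: CP_factor_def shadow_def adj inner_diff_right diff_divide_distrib sq)
  then have "\<forall>x p. CP_factor L \<sigma> x \<bullet> p = x \<bullet> ((1 / sqrt \<sigma>) *\<^sub>R shadow p)"
    by (metis prod.collapse)
  then have "adjoint (CP_factor L \<sigma>) = (\<lambda>p. (1 / sqrt \<sigma>) *\<^sub>R shadow p)"
    by (rule adjoint_unique)
  then show ?thesis by simp
qed

text \<open>
  The sum of the block operator and the preconditioner is lower triangular: the terms \<open>L\<^sup>* y\<close> cancel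
  in the first row, so \<open>x\<close> is determined first and then \<open>y\<close>.
\<close>
lemma reduced_op_resolvent_mem_iff:
  "(x, y) \<in> op_inverse (\<lambda>u. block_op A B L u + {CP_precond L \<sigma> \<tau> u})
      (CP_factor L \<sigma> ((1 / sqrt \<sigma>) *\<^sub>R w)) \<longleftrightarrow>
   resolvent (scale_op \<sigma> A) w = x \<and>
   resolvent (scale_op \<tau> (op_inverse B)) ((2 * \<tau>) *\<^sub>R L x - \<tau> *\<^sub>R L w) = y"
  (is "?l \<longleftrightarrow> _")
proof -
  have "?l \<longleftrightarrow> ((1 / \<sigma>) *\<^sub>R w, - L w) \<in> (A x + {adjoint L y}) \<times> ({- L x} + op_inverse B y)
      + {((1 / \<sigma>) *\<^sub>R x - adjoint L y, - L x + (1 / \<tau>) *\<^sub>R y)}"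
    using \<sigma> by (simp add: op_inverse_def block_op_def CP_precond_def CP_factor_def L.scaleR)
  also have "\<dots> \<longleftrightarrow>
      (\<exists>a\<in>A x. (1 / \<sigma>) *\<^sub>R w = a + adjoint L y + ((1 / \<sigma>) *\<^sub>R x - adjoint L y)) \<and>
      (\<exists>b\<in>op_inverse B y. - L w = - L x + b + (- L x + (1 / \<tau>) *\<^sub>R y))"
    unfolding set_plus_def by fastforce
  finally have "?l \<longleftrightarrow> \<dots>" .
  moreover have "(1 / \<sigma>) *\<^sub>R w = a + adjoint L y + ((1 / \<sigma>) *\<^sub>R x - adjoint L y)
      \<longleftrightarrow> a = (1 / \<sigma>) *\<^sub>R (w - x)" for a
    by (auto simp: algebra_simps)
  moreover have "- L w = - L x + b + (- L x + (1 / \<tau>) *\<^sub>R y)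
      \<longleftrightarrow> b = (1 / \<tau>) *\<^sub>R ((2 * \<tau>) *\<^sub>R L x - \<tau> *\<^sub>R L w - y)" for b
    using \<tau> by (auto simp: algebra_simps scaleR_2)
  ultimately have "?l \<longleftrightarrow> (1 / \<sigma>) *\<^sub>R (w - x) \<in> A x \<and>
      (1 / \<tau>) *\<^sub>R ((2 * \<tau>) *\<^sub>R L x - \<tau> *\<^sub>R L w - y) \<in> op_inverse B y"
    by simp
  then show ?thesis
    by (simp add: resolvent_eq_iff[OF A \<sigma>]
        resolvent_eq_iff[OF maximally_monotone_op_inverse[OF B] \<tau>])
qed

lemma reduced_op_eq:
  fixes w :: 'x
  defines "x \<equiv> resolvent (scale_op \<sigma> A) w"
  defines "y \<equiv> resolvent (scale_op \<tau> (op_inverse B)) ((2 * \<tau>) *\<^sub>R L x - \<tau> *\<^sub>R L w)"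
  shows "reduced_op A B L \<sigma> \<tau> ((1 / sqrt \<sigma>) *\<^sub>R w) = (1 / sqrt \<sigma>) *\<^sub>R shadow (x, y)"
proof -
  have "op_inverse (\<lambda>u. block_op A B L u + {CP_precond L \<sigma> \<tau> u})
      (CP_factor L \<sigma> ((1 / sqrt \<sigma>) *\<^sub>R w)) = {(x, y)}"
    using reduced_op_resolvent_mem_iff[of _ _ w] by (auto simp: x_def y_def)
  then show ?thesis by (simp add: reduced_op_def adjoint_CP_factor)
qed

text \<open>
  A fixed point \<open>w\<close> (rescaled by \<open>sqrt \<sigma>\<close>) is the shadow of the pair \<open>(x, y)\<close> that the resolvents produce
  from \<open>w\<close>, and for a pair with shadow \<open>w\<close> to be produced from \<open>w\<close> is the same as to lie in \<open>kkt\<close>.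
\<close>
lemma Fix_reduced_op:
  "Fix (reduced_op A B L \<sigma> \<tau>) = (*\<^sub>R) (1 / sqrt \<sigma>) ` shadow ` kkt A B L"
proof -
  have fix_iff: "(1 / sqrt \<sigma>) *\<^sub>R w \<in> Fix (reduced_op A B L \<sigma> \<tau>) \<longleftrightarrow> w \<in> shadow ` kkt A B L"
    for w
  proof -
    define x where "x = resolvent (scale_op \<sigma> A) w"
    define y where "y = resolvent (scale_op \<tau> (op_inverse B)) ((2 * \<tau>) *\<^sub>R L x - \<tau> *\<^sub>R L w)"
    have kkt_iff: "(x', y') \<in> kkt A B L \<longleftrightarrow> x' = x \<and> y' = y" if "shadow (x', y') = w" for x' y'
    proof -
      have "(x', y') \<in> kkt A B L \<longleftrightarrow> resolvent (scale_op \<sigma> A) w = x' \<and>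
          resolvent (scale_op \<tau> (op_inverse B)) ((2 * \<tau>) *\<^sub>R L x' - \<tau> *\<^sub>R L w) = y'"
        using primal_step_fixed_iff[of x' y'] dual_step_fixed_iff[of y' x']
        unfolding dual_step_argument that by (simp add: kkt_def)
      then show ?thesis by (auto simp: x_def y_def)
    qed
    have "(1 / sqrt \<sigma>) *\<^sub>R w \<in> Fix (reduced_op A B L \<sigma> \<tau>) \<longleftrightarrow> shadow (x, y) = w"
      using reduced_op_eq[of w] \<sigma> by (simp add: Fix_def x_def y_def)
    also have "\<dots> \<longleftrightarrow> w \<in> shadow ` kkt A B L"
      using kkt_iff by (auto simp: image_iff)
    finally show ?thesis .
  qed
  show ?thesis
  proof (intro equalityI subsetI)
    fix v assume "v \<in> Fix (reduced_op A B L \<sigma> \<tau>)"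
    moreover have v: "v = (1 / sqrt \<sigma>) *\<^sub>R (sqrt \<sigma> *\<^sub>R v)" using \<sigma> by simp
    ultimately have "sqrt \<sigma> *\<^sub>R v \<in> shadow ` kkt A B L" using fix_iff by metis
    then show "v \<in> (*\<^sub>R) (1 / sqrt \<sigma>) ` shadow ` kkt A B L" using v by (rule rev_image_eqI)
  next
    fix v assume "v \<in> (*\<^sub>R) (1 / sqrt \<sigma>) ` shadow ` kkt A B L"
    then obtain w where "v = (1 / sqrt \<sigma>) *\<^sub>R w" "w \<in> shadow ` kkt A B L" by (rule imageE)
    then show "v \<in> Fix (reduced_op A B L \<sigma> \<tau>)" by (simp only: fix_iff)
  qed
qed

text \<open>
  By orthogonality the two parts of a difference of shadows satisfy Pythagoras' theorem.
\<close>
lemma norm_shadow_diff_ge: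
  assumes "p \<in> kkt A B L" "q \<in> kkt A B L"
  shows "norm (fst p - fst q) \<le> norm (shadow p - shadow q)"
proof -
  obtain z k z' k' where pq: "p = (z, k)" "q = (z', k')" by fastforce
  define d where "d = adjoint L k - adjoint L k'"
  have "(z - z') \<bullet> d = 0"
    using assms kkt_inner_zero(1) by (simp add: pq d_def)
  then have "(norm (z - z' - \<sigma> *\<^sub>R d))\<^sup>2 = (norm (z - z'))\<^sup>2 + (norm (\<sigma> *\<^sub>R d))\<^sup>2"
    by (simp add: power2_norm_eq_inner inner_diff_left[of "z - z'"] inner_diff_right[of _ "z - z'"]
        inner_commute[of d "z - z'"] del: norm_scaleR)
  then have "(norm (z - z'))\<^sup>2 \<le> (norm (z - z' - \<sigma> *\<^sub>R d))\<^sup>2" by simp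
  then have "norm (z - z') \<le> norm (z - z' - \<sigma> *\<^sub>R d)" by (rule power2_le_imp_le) simp
  also have "z - z' - \<sigma> *\<^sub>R d = shadow p - shadow q"
    by (simp add: pq shadow_def d_def algebra_simps)
  finally show ?thesis by (simp add: pq)
qed

lemma inj_on_shadow_kkt: "inj_on shadow (kkt A B L)"
proof (rule inj_onI)
  fix p q assume pq: "p \<in> kkt A B L" "q \<in> kkt A B L" "shadow p = shadow q"
  then have "fst p = fst q" using norm_shadow_diff_ge[OF pq(1,2)] by simp
  moreover from this have "snd p = snd q"
    using dual_from_shadow[of "snd p" "fst p"] dual_from_shadow[of "snd q" "fst q"] pq(3)
    by (metis prod.collapse)
  ultimately show "p = q" by (simp add: prod_eq_iff)
qed

lemma convex_shadow_kkt: "convex (shadow ` kkt A B L)"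
  unfolding kkt_eq_Times
  by (intro convex_linear_image linear_shadow convex_Times
      closed_convex_primal_solutions closed_convex_dual_solutions)

text \<open>
  A convergent sequence of shadows has convergent primal parts by \<open>norm_shadow_diff_ge\<close>, and then
  convergent dual parts by \<open>dual_from_shadow\<close>; the limit is the shadow of the limiting pair.
\<close>
lemma closed_shadow_kkt: "closed (shadow ` kkt A B L)"
  unfolding closed_sequential_limits
proof (intro allI impI, elim conjE)
  fix w l assume "\<forall>n. w n \<in> shadow ` kkt A B L" and lim: "w \<longlonglongrightarrow> l"
  then obtain p where p: "\<And>n. p n \<in> kkt A B L" "\<And>n. w n = shadow (p n)"
    unfolding image_iff by metis
  have "Cauchy (\<lambda>n. fst (p n))"
  proof (rule metric_CauchyI)
    fix e :: real assume "e > 0"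
    then obtain N where "\<forall>m\<ge>N. \<forall>n\<ge>N. dist (w m) (w n) < e"
      using metric_CauchyD[OF LIMSEQ_imp_Cauchy[OF lim]] by blast
    then have "\<forall>m\<ge>N. \<forall>n\<ge>N. dist (fst (p m)) (fst (p n)) < e"
      using norm_shadow_diff_ge[OF p(1) p(1)] unfolding dist_norm p(2)
      by (meson le_less_trans)
    then show "\<exists>N. \<forall>m\<ge>N. \<forall>n\<ge>N. dist (fst (p m)) (fst (p n)) < e" ..
  qed
  then obtain z where z: "(\<lambda>n. fst (p n)) \<longlonglongrightarrow> z"
    using Cauchy_convergent convergent_def by blast
  define k where "k = \<tau> *\<^sub>R L (z - l)"
  have "snd (p n) = \<tau> *\<^sub>R L (fst (p n) - w n)" for n
    using dual_from_shadow[of "snd (p n)" "fst (p n)"] by (simp add: p(2))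
  moreover have "(\<lambda>n. \<tau> *\<^sub>R L (fst (p n) - w n)) \<longlonglongrightarrow> k"
    unfolding k_def by (intro tendsto_intros L.tendsto z lim)
  ultimately have k: "(\<lambda>n. snd (p n)) \<longlonglongrightarrow> k" by presburger
  have "z \<in> Z"
    by (rule closed_sequentially[OF closed_convex_primal_solutions(1) _ z])
       (use p(1) in \<open>auto simp: kkt_eq_Times mem_Times_iff\<close>)
  moreover have "k \<in> K"
    by (rule closed_sequentially[OF closed_convex_dual_solutions(1) _ k])
       (use p(1) in \<open>auto simp: kkt_eq_Times mem_Times_iff\<close>)
  moreover have "w n = fst (p n) - \<sigma> *\<^sub>R adjoint L (snd (p n))" for n
    by (simp add: p(2) shadow_def case_prod_beta)
  then have "w = (\<lambda>n. fst (p n) - \<sigma> *\<^sub>R adjoint L (snd (p n)))" by blast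
  then have "w \<longlonglongrightarrow> shadow (z, k)"
    unfolding shadow_def prod.case by (simp only:) (intro tendsto_intros Ladj.tendsto z k)
  then have "l = shadow (z, k)" using lim LIMSEQ_unique by blast
  ultimately show "l \<in> shadow ` kkt A B L" by (simp add: kkt_eq_Times)
qed

text \<open>
  This expresses that the preconditioner factors through its \<open>CP_factor\<close>.
\<close>
lemma op_seminorm_CP_precond:
  "op_seminorm (CP_precond L \<sigma> \<tau>) p = norm (shadow p) / sqrt \<sigma>"
proof -
  obtain x y where p: "p = (x, y)" by fastforce
  have "adjoint L y \<bullet> adjoint L y = L (adjoint L y) \<bullet> y" by (simp add: adj)
  also have "\<dots> = (y \<bullet> y) / (\<sigma> * \<tau>)"
  proof -
    have "(\<sigma> * \<tau>) * (L (adjoint L y) \<bullet> y) = y \<bullet> y"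
      using coisometry[of y] by (metis inner_scaleR_left)
    then show ?thesis using \<sigma> \<tau> by (simp add: field_simps)
  qed
  finally have adj_sq: "adjoint L y \<bullet> adjoint L y = (y \<bullet> y) / (\<sigma> * \<tau>)" .
  have "y \<bullet> L x = x \<bullet> adjoint L y" by (metis adj inner_commute)
  then have "p \<bullet> CP_precond L \<sigma> \<tau> p = (x \<bullet> x) / \<sigma> - 2 * (x \<bullet> adjoint L y) + (y \<bullet> y) / \<tau>"
    by (simp add: p CP_precond_def inner_diff_right inner_add_right)
  also have "\<dots> = (norm (shadow p))\<^sup>2 / \<sigma>"
    using \<sigma> \<tau>
    by (simp add: p shadow_def power2_norm_eq_inner inner_diff_left inner_diff_right
        inner_commute[of "adjoint L y" x] adj_sq field_simps)
  finally show ?thesis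
    using \<sigma> by (simp add: op_seminorm_def real_sqrt_divide)
qed

lemma is_seminorm_proj_iff:
  assumes "kkt A B L \<noteq> {}"
  shows "is_seminorm_proj (CP_precond L \<sigma> \<tau>) (kkt A B L) q p \<longleftrightarrow>
    p \<in> kkt A B L \<and> shadow p = proj (shadow ` kkt A B L) (shadow q)"
proof -
  have "op_seminorm (CP_precond L \<sigma> \<tau>) (u - q) = norm (shadow u - shadow q) / sqrt \<sigma>" for u
    by (simp add: op_seminorm_CP_precond linear_diff[OF linear_shadow])
  then have "is_seminorm_proj (CP_precond L \<sigma> \<tau>) (kkt A B L) q p \<longleftrightarrow> p \<in> kkt A B L \<and>
      is_arg_min (\<lambda>w. norm (w - shadow q)) (\<lambda>w. w \<in> shadow ` kkt A B L) (shadow p)"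
    using \<sigma> by (auto simp: is_seminorm_proj_def is_arg_min_linorder divide_le_cancel)
  then show ?thesis
    using assms convex_shadow_kkt closed_shadow_kkt by (simp add: is_arg_min_norm_iff_proj)
qed

text \<open>
  Compare \<open>z\<close> only with pairs that have the same dual part \<open>k\<close>. In the resulting variational inequality
  \<open>w - z\<close> is perturbed by \<open>\<sigma> L\<^sup>* k = \<sigma> (L\<^sup>* k - L\<^sup>* k0)\<close>, which is orthogonal to differences in \<open>Z\<close>.
\<close>
lemma primal_part_of_proj:
  assumes zk: "(z, k) \<in> kkt A B L" "shadow (z, k) = proj (shadow ` kkt A B L) w"
    and k0: "k0 \<in> K" "adjoint L k0 = 0"
  shows "proj Z w = z"
proof (rule proj_eqI)
  show "convex Z" by (rule closed_convex_primal_solutions)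
  show z: "z \<in> Z" using zk(1) by (simp add: kkt_eq_Times)
  have k: "k \<in> K" using zk(1) by (simp add: kkt_eq_Times)
  fix q assume q: "q \<in> Z"
  then have "shadow (q, k) \<in> shadow ` kkt A B L" using k by (simp add: kkt_eq_Times)
  then have "(w - shadow (z, k)) \<bullet> (shadow (q, k) - shadow (z, k)) \<le> 0"
    unfolding zk(2) by (intro proj_variational convex_shadow_kkt closed_shadow_kkt) auto
  moreover have "shadow (q, k) - shadow (z, k) = q - z" by (simp add: shadow_def)
  moreover have "(q - z) \<bullet> adjoint L k = 0"
    using solutions_orthogonal[OF q z k k0(1)] k0(2) by simp
  ultimately show "(w - z) \<bullet> (q - z) \<le> 0"
    by (simp add: shadow_def inner_diff_left inner_commute[of "adjoint L k"])
qed

end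

theorem corollary8p6:
  fixes A :: "'x::{real_inner, complete_space} \<Rightarrow> 'x set"
    and B :: "'y::{real_inner, complete_space} \<Rightarrow> 'y set"
    and L :: "'x \<Rightarrow> 'y"
    and \<sigma> \<tau> :: real
    and x0 :: 'x and y0 :: 'y
  defines "Z \<equiv> primal_solutions A B L"
    and "K \<equiv> dual_solutions A B L"
    and "ZK \<equiv> {z - \<sigma> *\<^sub>R adjoint L k | z k. z \<in> primal_solutions A B L \<and> k \<in> dual_solutions A B L}"
    and "w0 \<equiv> (1 / sqrt \<sigma>) *\<^sub>R (x0 - \<sigma> *\<^sub>R adjoint L y0)"
    and "FixTt \<equiv> Fix (reduced_op A B L \<sigma> \<tau>)"
    and "FixT \<equiv> Fix (CP_op A B L \<sigma> \<tau>)"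
    and "M \<equiv> CP_precond L \<sigma> \<tau>"
  assumes "bounded_linear L"
    and "maximally_monotone A" and "maximally_monotone B"
    and "\<sigma> > 0" and "\<tau> > 0" and "\<sigma> * \<tau> * (onorm L)\<^sup>2 \<le> 1"
    and "paramonotone A" and "paramonotone B"
    and "\<forall>y. (\<sigma> * \<tau>) *\<^sub>R L (adjoint L y) = y"
    and "K \<inter> {y. adjoint L y = 0} \<noteq> {}"
  shows "FixTt \<noteq> {} \<and> closed FixTt \<and> convex FixTt
       \<and> Z \<noteq> {} \<and> closed Z \<and> convex Z
       \<and> ZK \<noteq> {} \<and> closed ZK \<and> convex ZK
       \<and> proj FixTt w0 = (1 / sqrt \<sigma>) *\<^sub>R proj ZK (sqrt \<sigma> *\<^sub>R w0)
       \<and> (\<exists>!p. is_seminorm_proj M FixT (x0, y0) p)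
       \<and> seminorm_proj M FixT (x0, y0) =
           (proj Z (x0 - \<sigma> *\<^sub>R adjoint L y0),
            resolvent (scale_op \<tau> (op_inverse B))
              ((2 * \<tau>) *\<^sub>R L (proj Z (x0 - \<sigma> *\<^sub>R adjoint L y0))
               - \<tau> *\<^sub>R L (proj ZK (sqrt \<sigma> *\<^sub>R w0))))"
proof -
  interpret cp: coisometric_chambolle_pock A B L \<sigma> \<tau>
    using assms(8-12,14-16)
    by (intro coisometric_chambolle_pock.intro primal_dual_pair.intro
        coisometric_chambolle_pock_axioms.intro) auto
  note \<sigma> = \<open>\<sigma> > 0\<close>
  define w where "w = cp.shadow (x0, y0)"
  have w: "x0 - \<sigma> *\<^sub>R adjoint L y0 = w" "w0 = (1 / sqrt \<sigma>) *\<^sub>R w" "sqrt \<sigma> *\<^sub>R w0 = w"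
    using \<sigma> by (simp_all add: w_def w0_def cp.shadow_def)
  obtain k0 where k0: "k0 \<in> K" "adjoint L k0 = 0" using assms(17) by blast
  have ZK: "ZK = cp.shadow ` kkt A B L"
    by (force simp: ZK_def cp.kkt_eq_Times cp.shadow_def)
  have ne: "kkt A B L \<noteq> {}" using k0(1) by (auto simp: K_def dual_solutions_eq)
  have Z: "Z \<noteq> {}" "closed Z" "convex Z"
    using ne cp.closed_convex_primal_solutions by (auto simp: Z_def primal_solutions_eq)
  have ZK': "ZK \<noteq> {}" "closed ZK" "convex ZK"
    using ne cp.closed_shadow_kkt cp.convex_shadow_kkt by (auto simp: ZK)
  have FixTt: "FixTt = (*\<^sub>R) (1 / sqrt \<sigma>) ` ZK"
    by (simp add: FixTt_def ZK cp.Fix_reduced_op)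
  have "proj ZK w \<in> cp.shadow ` kkt A B L"
    using proj_in[of ZK w] ZK' ZK by blast
  then obtain z k where zk: "(z, k) \<in> kkt A B L" "cp.shadow (z, k) = proj ZK w"
    by (metis imageE prod.collapse)
  have "FixTt \<noteq> {}" "closed FixTt" "convex FixTt"
    using ZK' by (simp_all only: FixTt closed_scaling convex_scaling image_is_empty not_False_eq_True)
  moreover have "proj FixTt w0 = (1 / sqrt \<sigma>) *\<^sub>R proj ZK w"
    unfolding FixTt w(2) using ZK' by (intro proj_scaleR)
  \<comment> \<open>the seminorm distinguishes the pairs in \<open>kkt\<close>, since \<open>shadow\<close> is injective there\<close>
  moreover have sproj: "is_seminorm_proj M FixT (x0, y0) p \<longleftrightarrow> p = (z, k)" for p
    using cp.is_seminorm_proj_iff[OF ne, of "(x0, y0)" p] zk inj_onD[OF cp.inj_on_shadow_kkt, of p "(z, k)"]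
    by (auto simp: M_def FixT_def cp.Fix_CP_op w_def ZK)
  then have "\<exists>!p. is_seminorm_proj M FixT (x0, y0) p" "seminorm_proj M FixT (x0, y0) = (z, k)"
    by (auto simp: seminorm_proj_def)
  moreover have "proj Z w = z"
    using cp.primal_part_of_proj[OF zk(1)] zk(2) k0 by (simp add: ZK Z_def K_def)
  moreover have "resolvent (scale_op \<tau> (op_inverse B)) ((2 * \<tau>) *\<^sub>R L z - \<tau> *\<^sub>R L (proj ZK w)) = k"
    using cp.dual_step_fixed_iff[of k z] zk by (simp add: cp.dual_step_argument kkt_def)
  ultimately show ?thesis
    using Z ZK' unfolding w(1,3) by simp
qed

end
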